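(* For any Boolean algebra $\mathbb{A}$, $\mathsf{CO}\mathcal{RO}(UV(\mathbb{A}))=\mathsf{CRO}(UV(\mathbb{A}))$.
   Context: The base theory is ZF (no choice principles). For a Boolean algebra $\mathbb{A}$, $UV(\mathbb{A})$ is the space whose points are the proper filters of $\mathbb{A}$ and whose topology is generated by the sets $\widehat{a}=\{F \mid F \text{ a proper filter of } \mathbb{A},\ a\in F\}$, $a\in\mathbb{A}$. For a topological space $X$, its specialization order is: $x\leqslant y$ iff every open set containing $x$ contains $y$. For $U\subseteq X$, put $\mathsf{cl}_\leqslant(U)=\{x\in X\mid \exists y\in X: x\leqslant y,\ y\in U\}$ and $\mathsf{int}_\leqslant(U)=\{x\in X\mid \forall y\in X:\ x\leqslant y\Rightarrow y\in U\}$. $\mathcal{RO}(X)$ is the collection of sets $U\subseteq X$ with $U=\mathsf{int}_\leqslant(\mathsf{cl}_\leqslant(U))$ (the regular open sets of the topology of $\leqslant$-upsets). $\mathsf{CO}\mathcal{RO}(X)$ is the collection of subsets of $X$ that are compact and open in $X$ and belong to $\mathcal{RO}(X)$. $\mathsf{CRO}(X)$ is the collection of subsets of $X$ that are compact and regular open in $X$ itself, i.e. equal to the interior of their closure in the topology of $X$. *)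

theory Defs
  imports "HOL-Analysis.Function_Topology"
begin

definition ba_filter :: "'a::boolean_algebra set \<Rightarrow> bool" where
  "ba_filter F \<longleftrightarrow>
     F \<noteq> {} \<and> (\<forall>a\<in>F. \<forall>b. a \<le> b \<longrightarrow> b \<in> F) \<and> (\<forall>a\<in>F. \<forall>b\<in>F. inf a b \<in> F)"

definition proper_ba_filter :: "'a::boolean_algebra set \<Rightarrow> bool" where
  "proper_ba_filter F \<longleftrightarrow> ba_filter F \<and> F \<noteq> UNIV"

definition hat :: "'a::boolean_algebra \<Rightarrow> 'a set set" where
  "hat a = {F. proper_ba_filter F \<and> a \<in> F}"

text \<open>
  The algebra is the whole type \<open>'a\<close>. It may be degenerate (\<open>bot = top\<close>), in which case
  there are no proper filters and the space is empty.
\<close>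

definition UV :: "'a::boolean_algebra itself \<Rightarrow> 'a set topology" where
  "UV _ = topology_generated_by (range (hat :: 'a \<Rightarrow> 'a set set))"

lemma topspace_UV: "topspace (UV TYPE('a::boolean_algebra)) = {F :: 'a set. proper_ba_filter F}"
proof -
  have "top \<in> F" if "proper_ba_filter F" for F :: "'a set"
    using that top_greatest unfolding proper_ba_filter_def ba_filter_def by blast
  then show ?thesis
    by (auto simp: UV_def topology_generated_by_topspace hat_def)
qed

definition spec_le :: "'x topology \<Rightarrow> 'x \<Rightarrow> 'x \<Rightarrow> bool" where
  "spec_le X x y \<longleftrightarrow> (\<forall>U. openin X U \<and> x \<in> U \<longrightarrow> y \<in> U)"

definition cl_le :: "'x topology \<Rightarrow> 'x set \<Rightarrow> 'x set" where
  "cl_le X U = {x \<in> topspace X. \<exists>y\<in>topspace X. spec_le X x y \<and> y \<in> U}"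

definition int_le :: "'x topology \<Rightarrow> 'x set \<Rightarrow> 'x set" where
  "int_le X U = {x \<in> topspace X. \<forall>y\<in>topspace X. spec_le X x y \<longrightarrow> y \<in> U}"

text \<open>
  \<open>RO\<close> is regular openness for the topology of specialization upsets, whereas \<open>CRO\<close> below
  uses interior and closure in \<open>X\<close> itself.
\<close>

definition RO :: "'x topology \<Rightarrow> 'x set set" where
  "RO X = {U. U \<subseteq> topspace X \<and> U = int_le X (cl_le X U)}"

definition CORO :: "'x topology \<Rightarrow> 'x set set" where
  "CORO X = {U. compactin X U \<and> openin X U \<and> U \<in> RO X}"

definition CRO :: "'x topology \<Rightarrow> 'x set set" where
  "CRO X = {U. compactin X U \<and> U = X interior_of (X closure_of U)}"

end

theory Submission
  imports Defs
begin

text \<open>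
  The specialization order of \<open>UV\<close> is inclusion of filters. In any space \<open>cl_le\<close> lies inside the
  topological closure and the topological interior lies inside \<open>int_le\<close>. A compact open set is
  a finite union of sets \<open>hat b\<close>; writing \<open>a\<close> for the join of these \<open>b\<close>, its order closure is
  the complement of \<open>hat (- a)\<close>. That set is closed, so it is also the topological closure, and
  its order interior is \<open>hat a\<close>, which is open, so it is also the topological interior. Hence the
  two notions of regular openness agree on compact open sets.
\<close>

lemma cl_le_subset_closure_of: "cl_le X U \<subseteq> X closure_of U"
  unfolding cl_le_def spec_le_def closure_of_def by blast

lemma interior_of_subset_int_le: "X interior_of U \<subseteq> int_le X U"
  unfolding int_le_def spec_le_def interior_of_def using openin_subset[of X] by blast

lemma ba_filter_upD: "ba_filter F \<Longrightarrow> a \<in> F \<Longrightarrow> a \<le> b \<Longrightarrow> b \<in> F"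
  by (auto simp: ba_filter_def)

lemma ba_filter_inf_iff: "ba_filter F \<Longrightarrow> inf a b \<in> F \<longleftrightarrow> a \<in> F \<and> b \<in> F"
  by (meson ba_filter_def inf_le1 inf_le2)

lemma ba_filter_top: "ba_filter F \<Longrightarrow> top \<in> F"
  unfolding ba_filter_def using top_greatest by blast

lemma proper_ba_filter_iff: "proper_ba_filter F \<longleftrightarrow> ba_filter F \<and> bot \<notin> F"
  by (auto simp: proper_ba_filter_def intro: ba_filter_upD)

lemma proper_ba_filter_not_both:
  "proper_ba_filter F \<Longrightarrow> a \<in> F \<Longrightarrow> - a \<notin> F"
  by (metis ba_filter_inf_iff inf_compl_bot proper_ba_filter_iff)

text \<open>The filter generated by \<open>F\<close> and \<open>b\<close> serves as
  \<open>G\<close>. If it contained \<open>bot\<close>, some \<open>c\<close> in \<open>F\<close>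
  would satisfy \<open>inf c b = bot\<close>, that is \<open>c \<le> - b\<close>, which forces
  \<open>- b\<close> into \<open>F\<close>. Only one element is added, so no ultrafilter and no
  choice is involved.\<close>

lemma proper_ba_filter_extend:
  fixes b :: "'a::boolean_algebra"
  assumes F: "proper_ba_filter F" and b: "- b \<notin> F"
  obtains G where "proper_ba_filter G" "F \<subseteq> G" "b \<in> G"
proof
  define G where "G = {x. \<exists>c\<in>F. inf c b \<le> x}"
  have filter: "ba_filter F"
    using F by (simp add: proper_ba_filter_def)
  show "F \<subseteq> G"
    by (auto simp: G_def intro: le_infI1)
  show "b \<in> G"
    using ba_filter_top[OF filter] by (auto simp: G_def)
  have "inf x y \<in> G" if xy: "x \<in> G" "y \<in> G" for x y
  proof -
    obtain c d where "c \<in> F" "inf c b \<le> x" "d \<in> F" "inf d b \<le> y"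
      using xy by (auto simp: G_def)
    moreover from this have "inf (inf c d) b \<le> inf x y"
      by (auto intro: order_trans[OF inf_mono[OF inf_le1 order_refl]]
          order_trans[OF inf_mono[OF inf_le2 order_refl]])
    ultimately show ?thesis
      using ba_filter_inf_iff[OF filter] by (auto simp: G_def)
  qed
  then have "ba_filter G"
    using \<open>b \<in> G\<close> by (auto simp: ba_filter_def G_def intro: order_trans)
  moreover have "bot \<notin> G"
  proof
    assume "bot \<in> G"
    then obtain c where "c \<in> F" "inf c b \<le> bot"
      by (auto simp: G_def)
    then show False
      using b ba_filter_upD[OF filter, of c "- b"] by (simp add: inf_shunt[symmetric] le_bot)
  qed
  ultimately show "proper_ba_filter G"
    by (simp add: proper_ba_filter_iff)
qed

text \<open>The witness is the join of \<open>B\<close>, by De Morgan. Complements are used because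
  meets are computed pointwise in every filter, whereas a filter that is not prime may contain a
  join without containing any of its members.\<close>

lemma ba_filter_finite_compl:
  fixes B :: "'a::boolean_algebra set"
  assumes "finite B"
  shows "\<exists>a. \<forall>F. ba_filter F \<longrightarrow> (- a \<in> F \<longleftrightarrow> (\<forall>b\<in>B. - b \<in> F))"
  using assms
proof (induction B rule: finite_induct)
  case empty
  show ?case
    by (rule exI[of _ bot]) (simp add: ba_filter_top)
next
  case (insert x B)
  then obtain a where "\<forall>F. ba_filter F \<longrightarrow> (- a \<in> F \<longleftrightarrow> (\<forall>b\<in>B. - b \<in> F))"
    by blast
  then have "\<forall>F. ba_filter F \<longrightarrow> (- sup x a \<in> F \<longleftrightarrow> (\<forall>b\<in>insert x B. - b \<in> F))"
    by (simp add: ba_filter_inf_iff)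
  then show ?case
    by blast
qed

lemma openin_UV_hat:
  fixes a :: "'a::boolean_algebra"
  shows "openin (UV TYPE('a)) (hat a)"
  by (simp add: UV_def topology_generated_by_Basis)

lemma hat_Int: "hat a \<inter> hat b = hat (inf a b)"
  by (auto simp: hat_def proper_ba_filter_def ba_filter_inf_iff)

text \<open>By \<open>hat_Int\<close> the generating sets are closed under binary intersection, so
  they form a base and not merely a subbase.\<close>

lemma openin_UV_hat_subset:
  fixes U :: "'a::boolean_algebra set set"
  assumes "openin (UV TYPE('a)) U" and "F \<in> U"
  obtains b :: 'a where "F \<in> hat b" "hat b \<subseteq> U"
proof -
  have "generate_topology_on (range (hat :: 'a \<Rightarrow> _)) U"
    using assms(1) by (simp add: UV_def openin_topology_generated_by)
  then have "\<forall>F\<in>U. \<exists>b :: 'a. F \<in> hat b \<and> hat b \<subseteq> U"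
  proof induction
    case (Int U V)
    then show ?case
      by (metis Int_iff Int_mono hat_Int)
  qed blast+
  then show thesis
    using assms(2) that by blast
qed

lemma spec_le_UV:
  fixes F G :: "'a::boolean_algebra set"
  assumes "proper_ba_filter F" "proper_ba_filter G"
  shows "spec_le (UV TYPE('a)) F G \<longleftrightarrow> F \<subseteq> G"
proof
  show "F \<subseteq> G" if "spec_le (UV TYPE('a)) F G"
    using that assms openin_UV_hat unfolding spec_le_def hat_def by blast
  show "spec_le (UV TYPE('a)) F G" if "F \<subseteq> G"
    unfolding spec_le_def
  proof (intro allI impI)
    fix U assume "openin (UV TYPE('a)) U \<and> F \<in> U"
    then obtain b where "F \<in> hat b" "hat b \<subseteq> U"
      using openin_UV_hat_subset by blast
    then show "G \<in> U"
      using that assms(2) by (auto simp: hat_def)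
  qed
qed

lemma compact_open_UV_finite:
  fixes U :: "'a::boolean_algebra set set"
  assumes "compactin (UV TYPE('a)) U" "openin (UV TYPE('a)) U"
  obtains B :: "'a set" where "finite B" "U = (\<Union>b\<in>B. hat b)"
proof -
  \<comment> \<open>All basic sets inside \<open>U\<close> cover it, and any subcover has union
    exactly \<open>U\<close>.\<close>
  let ?C = "hat ` {b :: 'a. hat b \<subseteq> U}"
  have "U \<subseteq> \<Union>?C"
    using openin_UV_hat_subset[OF assms(2)] by blast
  moreover have "openin (UV TYPE('a)) V" if "V \<in> ?C" for V
    using that by (auto simp: openin_UV_hat)
  ultimately obtain D where D: "finite D" "D \<subseteq> ?C" "U \<subseteq> \<Union>D"
    using compactinD[OF assms(1), of ?C] by metis
  obtain B where B: "B \<subseteq> {b. hat b \<subseteq> U}" "finite B" "D = hat ` B"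
    using finite_subset_image[OF D(1,2)] by blast
  then have "U = (\<Union>b\<in>B. hat b)"
    using D(3) by auto
  with B(2) show thesis
    by (rule that)
qed

lemma compact_open_UV_regularization:
  fixes U :: "'a::boolean_algebra set set"
  assumes "compactin (UV TYPE('a)) U" "openin (UV TYPE('a)) U"
  shows "int_le (UV TYPE('a)) (cl_le (UV TYPE('a)) U)
       = UV TYPE('a) interior_of (UV TYPE('a) closure_of U)"
proof -
  let ?X = "UV TYPE('a)"
  obtain B where "finite B" and U: "U = (\<Union>b\<in>B. hat b)"
    using compact_open_UV_finite[OF assms] .
  then obtain a where a: "\<And>F. ba_filter F \<Longrightarrow> - a \<in> F \<longleftrightarrow> (\<forall>b\<in>B. - b \<in> F)"
    using ba_filter_finite_compl by metis
  let ?C = "topspace ?X - hat (- a)"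
  have "closedin ?X ?C"
    by (simp add: closedin_diff openin_UV_hat)
  have "U \<subseteq> ?C"
  proof
    fix F assume "F \<in> U"
    then obtain b where "b \<in> B" "b \<in> F" "proper_ba_filter F"
      by (auto simp: U hat_def)
    moreover from this have "- b \<notin> F"
      using proper_ba_filter_not_both by blast
    ultimately show "F \<in> ?C"
      using a[of F] by (auto simp: topspace_UV hat_def proper_ba_filter_def)
  qed
  \<comment> \<open>A filter without \<open>- a\<close> lacks \<open>- b\<close> for some
    \<open>b\<close> in \<open>B\<close>. Adjoining \<open>b\<close> gives a point of
    \<open>U\<close> above it.\<close>
  have "?C \<subseteq> cl_le ?X U"
  proof
    fix F assume "F \<in> ?C"
    then have F: "proper_ba_filter F" "- a \<notin> F"
      by (auto simp: topspace_UV hat_def)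
    then obtain b where "b \<in> B" "- b \<notin> F"
      using a[of F] by (auto simp: proper_ba_filter_def)
    moreover from this obtain G where "proper_ba_filter G" "F \<subseteq> G" "b \<in> G"
      using proper_ba_filter_extend[OF F(1)] by blast
    ultimately show "F \<in> cl_le ?X U"
      using F(1) by (auto simp: cl_le_def topspace_UV U hat_def spec_le_UV)
  qed
  moreover have "?X closure_of U \<subseteq> ?C"
    using \<open>U \<subseteq> ?C\<close> \<open>closedin ?X ?C\<close> by (rule closure_of_minimal)
  \<comment> \<open>The inclusions close up: \<open>?C\<close> lies in the order closure, which lies
    in the topological closure, which lies in \<open>?C\<close>.\<close>
  ultimately have cl: "cl_le ?X U = ?C" "?X closure_of U = ?C"
    using cl_le_subset_closure_of[of ?X U] by blast+
  have "hat a \<subseteq> ?X interior_of ?C"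
  proof (rule interior_of_maximal)
    show "hat a \<subseteq> ?C"
      using proper_ba_filter_not_both by (auto simp: topspace_UV hat_def)
  qed (rule openin_UV_hat)
  moreover have "int_le ?X ?C \<subseteq> hat a"
  proof
    fix F assume F: "F \<in> int_le ?X ?C"
    then have "proper_ba_filter F"
      by (simp add: int_le_def topspace_UV)
    moreover have "a \<in> F"
    proof (rule ccontr)
      assume "a \<notin> F"
      \<comment> \<open>Since \<open>a\<close> is the complement of \<open>- a\<close>, the element
        \<open>- a\<close> can be adjoined to \<open>F\<close>. The result is a point above
        \<open>F\<close> outside \<open>?C\<close>.\<close>
      then obtain G where "proper_ba_filter G" "F \<subseteq> G" "- a \<in> G"
        using proper_ba_filter_extend[OF \<open>proper_ba_filter F\<close>, of "- a"] by auto
      then show False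
        using F \<open>proper_ba_filter F\<close>
        by (auto simp: int_le_def topspace_UV hat_def spec_le_UV)
    qed
    ultimately show "F \<in> hat a"
      by (simp add: hat_def)
  qed
  ultimately show ?thesis
    using interior_of_subset_int_le[of ?X ?C] unfolding cl by blast
qed

theorem corollary4p2:
  shows "CORO (UV TYPE('a::boolean_algebra)) = CRO (UV TYPE('a))"
proof (intro set_eqI)
  fix U :: "'a set set"
  let ?X = "UV TYPE('a)"
  \<comment> \<open>Members of \<open>CRO\<close> are open because they are interiors, so on both
    sides only compact open sets remain to be compared.\<close>
  have "openin ?X U" if "U = ?X interior_of (?X closure_of U)"
    using that openin_interior_of by metis
  then show "U \<in> CORO ?X \<longleftrightarrow> U \<in> CRO ?X"
    using compact_open_UV_regularization[of U] openin_subset[of ?X U]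
    by (auto simp: CORO_def CRO_def RO_def)
qed

end
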